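(* Let $r_0>0$ and $p\in(0,1)$, $q=1-p$. Define the experiments $\mathscr{P}=\{\mathbb{P}_{r,p}\}_{r\ge r_0}$, where $\mathbb{P}_{r,p}$ is the measure induced by $\mathrm{NegBin}(r,p)$, and $\mathscr{Q}=\{\mathbb{Q}_{r,p}\}_{r\ge r_0}$, where $\mathbb{Q}_{r,p}$ is the measure induced by $\mathrm{Normal}(rpq^{-1},rpq^{-2})$ (mean $rpq^{-1}$, variance $rpq^{-2}$). Then the Le Cam distance between $\mathscr{P}$ and $\mathscr{Q}$ satisfies $$\Delta(\mathscr{P},\mathscr{Q})=\max\{\delta(\mathscr{P},\mathscr{Q}),\delta(\mathscr{Q},\mathscr{P})\}\le C_p\,r_0^{-1/2},$$ where $C_p>0$ is a constant that depends only on $p$ and $$\delta(\mathscr{P},\mathscr{Q})=\inf_{T_1}\sup_{r\ge r_0}\left\|\int_{\mathbb{N}_0}T_1(k,\cdot)\,\mathbb{P}_{r,p}(\mathrm{d}k)-\mathbb{Q}_{r,p}\right\|,\qquad \delta(\mathscr{Q},\mathscr{P})=\inf_{T_2}\sup_{r\ge r_0}\left\|\mathbb{P}_{r,p}-\int_{\mathbb{R}}T_2(z,\cdot)\,\mathbb{Q}_{r,p}(\mathrm{d}z)\right\|,$$ the infima being taken, respectively, over all Markov kernels $T_1:\mathbb{N}_0\times\mathscr{B}(\mathbb{R})\to[0,1]$ and $T_2:\mathbb{R}\times\mathscr{B}(\mathbb{N}_0)\to[0,1]$.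
   Context: For real $r>0$, $p\in(0,1)$ and $q=1-p$, $\mathrm{NegBin}(r,p)$ is the law on $\mathbb{N}_0=\{0,1,2,\dots\}$ with probability mass function $P_{r,p}(k)=\frac{\Gamma(r+k)}{\Gamma(r)\,k!}q^r p^k$. $\|\cdot\|$ is the total variation norm, and $\mathscr{B}(\cdot)$ denotes the Borel $\sigma$-algebra. *)

theory Defs
  imports "HOL-Probability.Probability"
begin

definition neg_binomial_density :: "real \<Rightarrow> real \<Rightarrow> nat \<Rightarrow> real" where
  "neg_binomial_density r p k =
     Gamma (r + real k) / (Gamma r * fact k) * (1 - p) powr r * p ^ k"

definition neg_binomial_measure :: "real \<Rightarrow> real \<Rightarrow> nat measure" where
  "neg_binomial_measure r p =
     density (count_space UNIV) (\<lambda>k. ennreal (neg_binomial_density r p k))"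

(* The library's normal_density takes the standard deviation, hence the square root. *)
definition normal_measure :: "real \<Rightarrow> real \<Rightarrow> real measure" where
  "normal_measure m v = density lborel (\<lambda>x. ennreal (normal_density m (sqrt v) x))"

(* The total variation norm of the signed measure M - N, for finite measures M and N on the
   same sigma-algebra. There is no factor 1/2: for probability measures this is twice
   the supremum over measurable A of |M A - N A|. *)
definition tv_norm_diff :: "'a measure \<Rightarrow> 'a measure \<Rightarrow> ennreal" where
  "tv_norm_diff M N =
     (SUP F \<in> {F. finite F \<and> F \<subseteq> sets M \<and> partition_on (space M) F}.
        \<Sum>A\<in>F. ennreal \<bar>measure M A - measure N A\<bar>)"

(* P i and Q i, for i in I, are probability measures on the measurable spaces M and N. A
   Markov kernel from M to N is a measurable map T from M to the probability
   measures on N, and P i \<bind> T is the mixture of the measures T x with x distributed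
   according to P i. *)
definition deficiency ::
  "'a measure \<Rightarrow> 'b measure \<Rightarrow> 'i set \<Rightarrow> ('i \<Rightarrow> 'a measure) \<Rightarrow> ('i \<Rightarrow> 'b measure) \<Rightarrow> ennreal" where
  "deficiency M N I P Q =
     (INF T \<in> M \<rightarrow>\<^sub>M prob_algebra N. SUP i\<in>I. tv_norm_diff (P i \<bind> T) (Q i))"

definition le_cam_distance ::
  "'a measure \<Rightarrow> 'b measure \<Rightarrow> 'i set \<Rightarrow> ('i \<Rightarrow> 'a measure) \<Rightarrow> ('i \<Rightarrow> 'b measure) \<Rightarrow> ennreal" where
  "le_cam_distance M N I P Q = max (deficiency M N I P Q) (deficiency N M I Q P)"

lemma prob_space_neg_binomial_measure:
  assumes "r > 0" "0 < p" "p < 1"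
  shows "prob_space (neg_binomial_measure r p)"
proof
  have nonneg: "neg_binomial_density r p k \<ge> 0" for k
    unfolding neg_binomial_density_def using assms
    by (intro mult_nonneg_nonneg divide_nonneg_nonneg less_imp_le[OF Gamma_real_pos]) auto
  have 1: "(- r gchoose k) * (- p) ^ k = Gamma (r + real k) / (Gamma r * fact k) * p ^ k" for k
  proof -
    have "(- r gchoose k) * (- p) ^ k = ((- 1) ^ k * (- 1) ^ k) * (pochhammer r k / fact k * p ^ k)"
      unfolding gbinomial_pochhammer power_minus[of p] by simp
    also have "(- 1) ^ k * (- 1) ^ k = (1 :: real)"
      by (simp flip: power_mult_distrib)
    also have "pochhammer r k = Gamma (r + real k) / Gamma r"
      using assms by (intro pochhammer_Gamma) auto
    finally show ?thesis by simp
  qed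
  have "(\<lambda>k. (- r gchoose k) * (- p) ^ k) sums (1 + - p) powr (- r)"
    using assms by (intro gen_binomial_real) auto
  hence "(\<lambda>k. (1 - p) powr r * (Gamma (r + real k) / (Gamma r * fact k) * p ^ k)) sums
           ((1 - p) powr r * (1 - p) powr (- r))"
    unfolding 1 by (intro sums_mult) simp
  moreover have "(1 - p) powr r * (1 - p) powr (- r) = 1"
    using assms by (simp flip: powr_add)
  moreover have "(1 - p) powr r * (Gamma (r + real k) / (Gamma r * fact k) * p ^ k) =
      neg_binomial_density r p k" for k
    unfolding neg_binomial_density_def by (simp only: mult_ac)
  ultimately have "neg_binomial_density r p sums 1"
    by simp
  hence "(\<Sum>k. ennreal (neg_binomial_density r p k)) = 1"
    using nonneg by (metis ennreal_1 suminf_ennreal_eq)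
  thus "emeasure (neg_binomial_measure r p) (space (neg_binomial_measure r p)) = 1"
    by (simp add: neg_binomial_measure_def emeasure_density nn_integral_count_space_nat)
qed

lemma prob_space_normal_measure:
  assumes "v > 0"
  shows "prob_space (normal_measure m v)"
  unfolding normal_measure_def using assms by (intro prob_space_normal_density) auto

end

theory Submission
  imports Defs
begin

text \<open>Write \<open>P\<close> for the negative binomial mass function, extended by \<open>0\<close> to negative integers, and
  \<open>m = r p / q\<close>, \<open>v = r p / q\<^sup>2\<close> for its mean and variance. The two kernels are explicit: an
  integer \<open>k\<close> is smeared uniformly over \<open>[k, k + 1)\<close>, and a real number is rounded down
  (negative ones to \<open>0\<close>). Smearing \<open>P\<close> gives the density \<open>s x = P \<lfloor>x\<rfloor>\<close>, and rounding undoes the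
  smearing exactly. Applying a common map cannot increase a total variation distance, so both
  deficiencies are bounded by the supremum over \<open>r \<ge> r0\<close> of the \<open>L\<^sup>1\<close> distance from \<open>s\<close> to the
  normal density \<open>\<phi>\<close>. It remains to show that this distance is \<open>O(1 / sqrt r)\<close>.

  This is done without Stirling's formula, in the spirit of Stein's method. The normal density
  solves \<open>\<phi>' = - (x - m) / v * \<phi>\<close>. If \<open>f' = h - (x - m) / v * f\<close>, then \<open>(f / \<phi>)' = h / \<phi>\<close>, and
  integrating from \<open>m\<close> shows that \<open>f\<close> is within \<open>sqrt (2 \<pi> v) * \<integral>\<bar>h\<bar>\<close> of a multiple of \<open>\<phi>\<close> in
  \<open>L\<^sup>1\<close> (\<open>gaussian_comparison_L1\<close>). For \<open>f\<close> take the piecewise linear interpolation of \<open>P\<close>.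
  The recurrence \<open>(k + 1) P (k + 1) = p (r + k) P k\<close> is a discrete version of the differential
  equation, so \<open>h\<close> should be small, namely \<open>\<integral>\<bar>h\<bar> = O(1 / r)\<close>; as \<open>sqrt v = O(sqrt r)\<close>, this is what
  is needed.

  All error terms are controlled by one exact identity. With \<open>d k = P (k + 1) - P k\<close> and
  \<open>u k = k - m + 1 / q\<close>, the recurrence reads \<open>(k + 1) d k = - q u k P k\<close>: the sequence \<open>P\<close> rises
  where \<open>u < 0\<close> and falls where \<open>u > 0\<close>. Hence \<open>\<bar>u d\<bar> = - u d\<close>, whose sum telescopes to \<open>\<Sum> P = 1\<close>
  (\<open>negbin_weighted_variation\<close>). It also yields \<open>\<Sum>\<bar>d\<bar> = O(1 / sqrt r)\<close>
  (\<open>negbin_variation_bound\<close>), which is the cost of replacing \<open>s\<close> by its interpolation. The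
  identity needs \<open>r \<ge> 1\<close>; for smaller \<open>r\<close> the trivial bound \<open>2\<close> is good enough. Finally the unknown
  multiple of \<open>\<phi>\<close> must be close to \<open>\<phi>\<close> itself because both densities have mass \<open>1\<close>
  (\<open>L1_dist_le_of_scaled\<close>).

  All sums over the integers are written as Lebesgue integrals of functions of \<open>\<lfloor>x\<rfloor>\<close>, so
  that telescoping becomes translation invariance of Lebesgue measure.\<close>

section \<open>Total variation and \<open>L\<^sup>1\<close> distance\<close>

text \<open>Pushing both measures forward along the same map can only decrease the distance, because the
  preimages of a partition of the target are disjoint and each of them contributes at most its
  share of \<open>\<integral>\<bar>f - g\<bar>\<close>.\<close>

lemma tv_norm_diff_distr_density_le:
  fixes f g :: "'a \<Rightarrow> real"
  assumes f: "integrable M f" and f0: "\<And>x. f x \<ge> 0"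
    and g: "integrable M g" and g0: "\<And>x. g x \<ge> 0"
    and t [measurable]: "t \<in> M \<rightarrow>\<^sub>M N"
  shows "tv_norm_diff (distr (density M f) N t) (distr (density M g) N t)
           \<le> (\<integral>\<^sup>+x. ennreal \<bar>f x - g x\<bar> \<partial>M)"
  unfolding tv_norm_diff_def
proof (rule SUP_least)
  have [measurable]: "f \<in> borel_measurable M" "g \<in> borel_measurable M"
    using f g by auto
  fix F assume "F \<in> {F. finite F \<and> F \<subseteq> sets (distr (density M f) N t) \<and>
      partition_on (space (distr (density M f) N t)) F}"
  then have F: "finite F" "F \<subseteq> sets N" "partition_on (space N) F"
    by auto
  define B where "B A = t -` A \<inter> space M" for A
  have BM: "B A \<in> sets M" if "A \<in> F" for A
    using that F(2) unfolding B_def by (auto intro: measurable_sets[OF t])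
  have meas: "measure (distr (density M k) N t) A = (\<integral>x. indicator (B A) x * k x \<partial>M)"
    if A: "A \<in> F" and k: "integrable M k" "\<And>x. k x \<ge> 0" for A and k :: "'a \<Rightarrow> real"
  proof -
    have [measurable]: "k \<in> borel_measurable M" "B A \<in> sets M" "A \<in> sets N"
      using k BM[OF A] A F(2) by auto
    have "emeasure (distr (density M k) N t) A = emeasure (density M k) (B A)"
      by (simp add: emeasure_distr B_def)
    also have "\<dots> = (\<integral>\<^sup>+x. ennreal (indicator (B A) x * k x) \<partial>M)"
      by (subst emeasure_density) (auto intro!: nn_integral_cong simp: indicator_def)
    also have "\<dots> = ennreal (\<integral>x. indicator (B A) x * k x \<partial>M)"
      using k integrable_real_mult_indicator[OF BM[OF A] k(1)]
      by (intro nn_integral_eq_integral) (auto simp: mult.commute)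
    finally show ?thesis
      using k by (simp add: measure_def integral_nonneg)
  qed
  have "ennreal \<bar>measure (distr (density M f) N t) A - measure (distr (density M g) N t) A\<bar>
      \<le> (\<integral>\<^sup>+x. ennreal \<bar>f x - g x\<bar> * indicator (B A) x \<partial>M)" if A: "A \<in> F" for A
  proof -
    have i: "integrable M (\<lambda>x. indicator (B A) x * k x)" if "integrable M k" for k :: "'a \<Rightarrow> real"
      using integrable_real_mult_indicator[OF BM[OF A] that] by (simp add: mult.commute)
    have "measure (distr (density M f) N t) A - measure (distr (density M g) N t) A
          = (\<integral>x. indicator (B A) x * f x - indicator (B A) x * g x \<partial>M)"
      using i f g by (simp add: meas A f0 g0)
    also have "ennreal \<bar>\<dots>\<bar> \<le> (\<integral>\<^sup>+x. norm (indicator (B A) x * f x - indicator (B A) x * g x) \<partial>M)"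
      using integral_norm_bound_ennreal[of M "\<lambda>x. indicator (B A) x * f x - indicator (B A) x * g x"] i f g
      by simp
    also have "\<dots> = (\<integral>\<^sup>+x. ennreal \<bar>f x - g x\<bar> * indicator (B A) x \<partial>M)"
      by (intro nn_integral_cong) (auto simp: indicator_def)
    finally show ?thesis .
  qed
  then have "(\<Sum>A\<in>F. ennreal \<bar>measure (distr (density M f) N t) A - measure (distr (density M g) N t) A\<bar>)
      \<le> (\<Sum>A\<in>F. \<integral>\<^sup>+x. ennreal \<bar>f x - g x\<bar> * indicator (B A) x \<partial>M)"
    by (rule sum_mono)
  also have "\<dots> = (\<integral>\<^sup>+x. (\<Sum>A\<in>F. ennreal \<bar>f x - g x\<bar> * indicator (B A) x) \<partial>M)"
    using BM by (subst nn_integral_sum) auto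
  also have "\<dots> \<le> (\<integral>\<^sup>+x. ennreal \<bar>f x - g x\<bar> \<partial>M)"
  proof (rule nn_integral_mono)
    fix x assume x: "x \<in> space M"
    have "t x \<in> space N" using x measurable_space[OF t] by auto
    then obtain A0 where A0: "A0 \<in> F" "t x \<in> A0"
      using F(3) unfolding partition_on_def by auto
    have "indicator (B A) x = (if A = A0 then 1 else 0 :: ennreal)" if "A \<in> F" for A
      using F(3) A0 that x unfolding partition_on_def disjoint_def B_def indicator_def by auto
    then have "(\<Sum>A\<in>F. ennreal \<bar>f x - g x\<bar> * indicator (B A) x)
        = (\<Sum>A\<in>F. if A = A0 then ennreal \<bar>f x - g x\<bar> else 0)"
      by (intro sum.cong) auto
    then show "(\<Sum>A\<in>F. ennreal \<bar>f x - g x\<bar> * indicator (B A) x) \<le> ennreal \<bar>f x - g x\<bar>"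
      using F(1) A0 by simp
  qed
  finally show "(\<Sum>A\<in>F. ennreal \<bar>measure (distr (density M f) N t) A - measure (distr (density M g) N t) A\<bar>)
      \<le> (\<integral>\<^sup>+x. ennreal \<bar>f x - g x\<bar> \<partial>M)" .
qed

text \<open>Comparison with an arbitrary multiple of a probability density suffices: integrating
  \<open>f - c * g\<close> shows that \<open>\<bar>1 - c\<bar>\<close> is no larger than the distance already measured.\<close>

lemma L1_dist_le_of_scaled:
  fixes f g :: "'a \<Rightarrow> real"
  assumes f: "integrable M f" and g: "integrable M g"
    and 1: "(\<integral>x. f x \<partial>M) = 1" "(\<integral>x. g x \<partial>M) = 1" and g0: "\<And>x. g x \<ge> 0"
  shows "(\<integral>x. \<bar>f x - g x\<bar> \<partial>M) \<le> 2 * (\<integral>x. \<bar>f x - c * g x\<bar> \<partial>M)"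
proof -
  have "\<bar>1 - c\<bar> = \<bar>\<integral>x. f x - c * g x \<partial>M\<bar>"
    using f g 1 by simp
  also have "\<dots> \<le> (\<integral>x. \<bar>f x - c * g x\<bar> \<partial>M)"
    by (rule integral_abs_bound)
  finally have *: "\<bar>1 - c\<bar> \<le> (\<integral>x. \<bar>f x - c * g x\<bar> \<partial>M)" .
  have "(\<integral>x. \<bar>f x - g x\<bar> \<partial>M) \<le> (\<integral>x. \<bar>f x - c * g x\<bar> + \<bar>1 - c\<bar> * g x \<partial>M)"
  proof (rule integral_mono)
    fix x
    have "\<bar>f x - g x\<bar> = \<bar>(f x - c * g x) - (1 - c) * g x\<bar>"
      by (simp add: algebra_simps)
    also have "\<dots> \<le> \<bar>f x - c * g x\<bar> + \<bar>(1 - c) * g x\<bar>"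
      by (rule abs_triangle_ineq4)
    finally show "\<bar>f x - g x\<bar> \<le> \<bar>f x - c * g x\<bar> + \<bar>1 - c\<bar> * g x"
      using g0[of x] by (simp add: abs_mult)
  qed (use f g in auto)
  also have "\<dots> = (\<integral>x. \<bar>f x - c * g x\<bar> \<partial>M) + \<bar>1 - c\<bar>"
    using f g 1 by simp
  finally show ?thesis using * by simp
qed

section \<open>Gaussian comparison for perturbed differential equations\<close>

lemma gaussian_kernel_eq:
  assumes "v > 0"
  shows "exp (- (x - t)\<^sup>2 / (2 * v)) = sqrt (2 * pi * v) * normal_density t (sqrt v) x"
  using assms by (simp add: normal_density_def)

text \<open>Multiplying by the reciprocal Gaussian weight turns the perturbed differential equation into
  \<open>(f * W)' = h * W\<close>. The inhomogeneity at \<open>t\<close> reaches \<open>x\<close> with the factor \<open>W t / W x\<close>, and for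
  \<open>t\<close> between \<open>m\<close> and \<open>x\<close> this factor is at most a Gaussian in \<open>x - t\<close>, which makes the bound a
  convolution. The exceptional set \<open>S\<close> admits functions with corners.\<close>

lemma gaussian_comparison_pointwise:
  fixes f h :: "real \<Rightarrow> real"
  assumes v: "v > 0" and f: "continuous_on UNIV f" and h: "integrable lborel h"
    and S: "\<And>a b. finite (S \<inter> {a..b})"
    and deriv: "\<And>x. x \<notin> S \<Longrightarrow> (f has_real_derivative (h x - (x - m) / v * f x)) (at x)"
  shows "\<bar>f x - f m * exp (- (x - m)\<^sup>2 / (2 * v))\<bar> \<le> (\<integral>t. \<bar>h t\<bar> * exp (- (x - t)\<^sup>2 / (2 * v)) \<partial>lborel)"
proof -
  define W where "W t = exp ((t - m)\<^sup>2 / (2 * v))" for t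
  define J where "J t = \<bar>h t\<bar> * exp (- (x - t)\<^sup>2 / (2 * v))" for t
  define a b where "a = min x m" and "b = max x m"
  have [measurable]: "h \<in> borel_measurable borel" using h by auto
  have [measurable]: "J \<in> borel_measurable borel" unfolding J_def by measurable
  have "integrable lborel J"
    by (rule Bochner_Integration.integrable_bound[OF h])
       (use v in \<open>auto simp: J_def abs_mult mult_left_le\<close>)
  then have J: "(J has_integral (\<integral>t. J t \<partial>lborel)) UNIV"
    by (rule has_integral_integral_lborel)
  then have Jab: "J integrable_on {a..b}"
    by (meson has_integral_integrable integrable_on_subinterval subset_UNIV)
  have J_le: "integral {a..b} J \<le> (\<integral>t. J t \<partial>lborel)"
    using integral_subset_le[of "{a..b}" UNIV J] J Jab
    by (auto simp: J_def has_integral_integrable_integral)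
  have "((\<lambda>t. h t * W t) has_integral (f b * W b - f a * W a)) {a..b}"
  proof (rule fundamental_theorem_of_calculus_interior_strong[where S = "S \<inter> {a..b}"])
    fix t assume "t \<in> {a<..<b} - S \<inter> {a..b}"
    then have "t \<notin> S" by auto
    have "(W has_real_derivative (W t * ((t - m) / v))) (at t)"
      unfolding W_def using v by (auto intro!: derivative_eq_intros simp: field_simps)
    from DERIV_mult[OF deriv[OF \<open>t \<notin> S\<close>] this]
    have "((\<lambda>t. f t * W t) has_real_derivative h t * W t) (at t)"
      by (simp add: algebra_simps)
    then show "((\<lambda>t. f t * W t) has_vector_derivative h t * W t) (at t)"
      by (simp add: has_real_derivative_iff_has_vector_derivative)
  next
    show "continuous_on {a..b} (\<lambda>t. f t * W t)"
      unfolding W_def using v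
      by (auto intro!: continuous_intros continuous_on_subset[OF f])
  qed (use S in \<open>auto simp: a_def b_def\<close>)
  then have FTC: "(\<lambda>t. h t * W t) integrable_on {a..b}"
      "integral {a..b} (\<lambda>t. h t * W t) = f b * W b - f a * W a"
    by (auto simp: has_integral_integrable_integral)
  have "\<bar>f x * W x - f m * W m\<bar> = \<bar>f b * W b - f a * W a\<bar>"
    by (auto simp: a_def b_def min_def max_def)
  also have "\<dots> \<le> integral {a..b} (\<lambda>t. W x * J t)"
    unfolding FTC(2)[symmetric] real_norm_def[symmetric]
  proof (rule Henstock_Kurzweil_Integration.integral_norm_bound_integral[OF FTC(1)])
    show "(\<lambda>t. W x * J t) integrable_on {a..b}"
      using Jab by (rule integrable_on_mult_right)
    fix t assume t: "t \<in> {a..b}"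
    \<comment> \<open>As \<open>t\<close> lies between \<open>m\<close> and \<open>x\<close>, the square of \<open>(x - t) + (t - m)\<close> dominates the sum of squares.\<close>
    then have "(x - t) * (t - m) \<ge> 0"
      by (auto simp: a_def b_def min_def max_def split: if_splits intro: mult_nonpos_nonpos)
    then have "(t - m)\<^sup>2 \<le> (x - m)\<^sup>2 - (x - t)\<^sup>2"
      by (simp add: power2_eq_square algebra_simps)
    then have "(t - m)\<^sup>2 / (2 * v) \<le> ((x - m)\<^sup>2 - (x - t)\<^sup>2) / (2 * v)"
      using v by (intro divide_right_mono) auto
    then have "W t \<le> W x * exp (- (x - t)\<^sup>2 / (2 * v))"
      by (simp add: W_def diff_divide_distrib flip: exp_add)
    from mult_left_mono[OF this, of "\<bar>h t\<bar>"] show "norm (h t * W t) \<le> W x * J t"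
      by (simp add: J_def W_def abs_mult algebra_simps)
  qed
  also have "\<dots> \<le> W x * (\<integral>t. J t \<partial>lborel)"
    using J_le by (simp add: W_def)
  finally have "\<bar>f x * W x - f m * W m\<bar> \<le> W x * (\<integral>t. J t \<partial>lborel)" .
  moreover have "f x * W x - f m * W m = W x * (f x - f m * exp (- (x - m)\<^sup>2 / (2 * v)))"
    by (simp add: W_def exp_minus field_simps)
  moreover have "W x > 0" by (simp add: W_def)
  ultimately have "\<bar>f x - f m * exp (- (x - m)\<^sup>2 / (2 * v))\<bar> \<le> (\<integral>t. J t \<partial>lborel)"
    by (simp add: abs_mult)
  then show ?thesis by (simp add: J_def)
qed

text \<open>Integrate the pointwise bound in \<open>x\<close> and exchange the integrals; the inner one is the total mass
  of a Gaussian kernel of variance \<open>v\<close>.\<close>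

lemma gaussian_comparison_L1:
  fixes f h :: "real \<Rightarrow> real"
  assumes v: "v > 0" and f: "continuous_on UNIV f" and h: "integrable lborel h"
    and S: "\<And>a b. finite (S \<inter> {a..b})"
    and deriv: "\<And>x. x \<notin> S \<Longrightarrow> (f has_real_derivative (h x - (x - m) / v * f x)) (at x)"
    and fi: "integrable lborel f"
  shows "\<exists>c. (\<integral>x. \<bar>f x - c * normal_density m (sqrt v) x\<bar> \<partial>lborel)
               \<le> sqrt (2 * pi * v) * (\<integral>x. \<bar>h x\<bar> \<partial>lborel)"
proof
  let ?\<phi> = "\<lambda>t. normal_density t (sqrt v)"
  let ?c = "f m * sqrt (2 * pi * v)"
  have [measurable]: "h \<in> borel_measurable borel" "f \<in> borel_measurable borel"
    using h fi by auto
  have sv: "sqrt v > 0" using v by simp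
  have \<phi>: "integrable lborel (?\<phi> t)" for t
    using sv by (rule integrable_normal_density)
  have ptw: "ennreal \<bar>f x - ?c * ?\<phi> m x\<bar>
      \<le> (\<integral>\<^sup>+t. ennreal (\<bar>h t\<bar> * sqrt (2 * pi * v)) * ennreal (?\<phi> t x) \<partial>lborel)" for x
  proof -
    have "integrable lborel (\<lambda>t. \<bar>h t\<bar> * exp (- (x - t)\<^sup>2 / (2 * v)))"
      by (rule Bochner_Integration.integrable_bound[OF h])
         (use v in \<open>auto simp: abs_mult mult_left_le\<close>)
    then have "ennreal (\<integral>t. \<bar>h t\<bar> * exp (- (x - t)\<^sup>2 / (2 * v)) \<partial>lborel)
        = (\<integral>\<^sup>+t. ennreal (\<bar>h t\<bar> * exp (- (x - t)\<^sup>2 / (2 * v))) \<partial>lborel)"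
      by (intro nn_integral_eq_integral[symmetric]) auto
    also have "\<dots> = (\<integral>\<^sup>+t. ennreal (\<bar>h t\<bar> * sqrt (2 * pi * v)) * ennreal (?\<phi> t x) \<partial>lborel)"
      unfolding gaussian_kernel_eq[OF v] using v by (simp add: ennreal_mult[symmetric] mult.assoc[symmetric])
    finally have eq: "ennreal (\<integral>t. \<bar>h t\<bar> * exp (- (x - t)\<^sup>2 / (2 * v)) \<partial>lborel)
        = (\<integral>\<^sup>+t. ennreal (\<bar>h t\<bar> * sqrt (2 * pi * v)) * ennreal (?\<phi> t x) \<partial>lborel)" .
    have "\<bar>f x - ?c * ?\<phi> m x\<bar> \<le> (\<integral>t. \<bar>h t\<bar> * exp (- (x - t)\<^sup>2 / (2 * v)) \<partial>lborel)"
      using gaussian_comparison_pointwise[OF v f h S deriv, of x]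
      unfolding gaussian_kernel_eq[OF v, of x m] by (simp add: mult.assoc)
    then show ?thesis
      unfolding eq[symmetric] by (rule ennreal_leI)
  qed
  have "integrable lborel (\<lambda>x. \<bar>f x - ?c * ?\<phi> m x\<bar>)"
    using fi \<phi> by auto
  then have "ennreal (\<integral>x. \<bar>f x - ?c * ?\<phi> m x\<bar> \<partial>lborel)
      = (\<integral>\<^sup>+x. ennreal \<bar>f x - ?c * ?\<phi> m x\<bar> \<partial>lborel)"
    by (intro nn_integral_eq_integral[symmetric]) auto
  also have "\<dots> \<le> (\<integral>\<^sup>+x. \<integral>\<^sup>+t. ennreal (\<bar>h t\<bar> * sqrt (2 * pi * v)) * ennreal (?\<phi> t x) \<partial>lborel \<partial>lborel)"
    by (intro nn_integral_mono ptw)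
  also have "\<dots> = (\<integral>\<^sup>+t. \<integral>\<^sup>+x. ennreal (\<bar>h t\<bar> * sqrt (2 * pi * v)) * ennreal (?\<phi> t x) \<partial>lborel \<partial>lborel)"
    by (rule lborel_pair.Fubini') (simp add: normal_density_def case_prod_beta')
  also have "\<dots> = (\<integral>\<^sup>+t. ennreal (\<bar>h t\<bar> * sqrt (2 * pi * v)) * (\<integral>\<^sup>+x. ennreal (?\<phi> t x) \<partial>lborel) \<partial>lborel)"
    by (intro nn_integral_cong nn_integral_cmult) simp
  also have "\<dots> = (\<integral>\<^sup>+t. ennreal (\<bar>h t\<bar> * sqrt (2 * pi * v)) \<partial>lborel)"
    using sv \<phi> by (simp add: nn_integral_eq_integral)
  also have "\<dots> = ennreal (\<integral>t. \<bar>h t\<bar> * sqrt (2 * pi * v) \<partial>lborel)"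
    using h v by (intro nn_integral_eq_integral) auto
  finally have "(\<integral>x. \<bar>f x - ?c * ?\<phi> m x\<bar> \<partial>lborel) \<le> (\<integral>t. \<bar>h t\<bar> * sqrt (2 * pi * v) \<partial>lborel)"
    using v by (subst (asm) ennreal_le_iff) auto
  then show "(\<integral>x. \<bar>f x - ?c * ?\<phi> m x\<bar> \<partial>lborel) \<le> sqrt (2 * pi * v) * (\<integral>x. \<bar>h x\<bar> \<partial>lborel)"
    by (simp add: mult.commute)
qed

section \<open>Piecewise linear interpolation\<close>

definition interpolate :: "(int \<Rightarrow> real) \<Rightarrow> real \<Rightarrow> real" where
  "interpolate a x = a \<lfloor>x\<rfloor> + (x - \<lfloor>x\<rfloor>) * (a (\<lfloor>x\<rfloor> + 1) - a \<lfloor>x\<rfloor>)"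

lemma interpolate_eq:
  assumes "of_int k \<le> x" "x \<le> of_int k + 1"
  shows "interpolate a x = a k + (x - of_int k) * (a (k + 1) - a k)"
proof (cases "x = of_int k + 1")
  case True
  then have "\<lfloor>x\<rfloor> = k + 1" by (simp add: floor_eq_iff)
  then show ?thesis using True by (simp add: interpolate_def)
next
  case False
  then have "\<lfloor>x\<rfloor> = k" using assms by (simp add: floor_eq_iff)
  then show ?thesis by (simp add: interpolate_def)
qed

text \<open>Every point \<open>x\<close> is interior to the union of the two cells that meet at \<open>\<lfloor>x\<rfloor>\<close>, on each of which the
  interpolation is affine including both end points.\<close>

lemma continuous_on_interpolate: "continuous_on A (interpolate a)"
proof -
  have "isCont (interpolate a) x" for x
  proof -
    define k where "k = \<lfloor>x\<rfloor>"
    have piece: "continuous_on {of_int j..of_int j + 1} (interpolate a)" for j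
      by (rule continuous_on_eq[where f = "\<lambda>x. a j + (x - of_int j) * (a (j + 1) - a j)"])
         (auto intro!: continuous_intros simp: interpolate_eq)
    have "continuous_on ({of_int (k - 1)..of_int (k - 1) + 1} \<union> {of_int k..of_int k + 1}) (interpolate a)"
      by (intro continuous_on_closed_Un piece) auto
    moreover have "{of_int (k - 1)<..<of_int k + 1} \<subseteq>
        {of_int (k - 1)..of_int (k - 1) + 1} \<union> {of_int k..of_int k + (1::real)}"
      by auto
    ultimately have "continuous_on {of_int (k - 1)<..<of_int k + 1} (interpolate a)"
      by (rule continuous_on_subset)
    moreover have "x \<in> {of_int (k - 1)<..<of_int k + 1}"
      unfolding k_def by simp linarith
    ultimately show ?thesis
      using continuous_on_eq_continuous_at[OF open_greaterThanLessThan] by blast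
  qed
  then show ?thesis by (simp add: continuous_at_imp_continuous_on)
qed

lemma interpolate_has_real_derivative:
  assumes "x \<notin> \<int>"
  shows "(interpolate a has_real_derivative (a (\<lfloor>x\<rfloor> + 1) - a \<lfloor>x\<rfloor>)) (at x)"
proof -
  define k where "k = \<lfloor>x\<rfloor>"
  have x: "x \<in> {of_int k<..<of_int k + 1}"
    using assms unfolding k_def by (auto simp: less_le) linarith
  have "((\<lambda>x. a k + (x - of_int k) * (a (k + 1) - a k)) has_real_derivative (a (k + 1) - a k)) (at x)"
    by (auto intro!: derivative_eq_intros)
  then have "(interpolate a has_real_derivative (a (k + 1) - a k)) (at x)"
    by (rule has_field_derivative_transform_within_open[where S = "{of_int k<..<of_int k + 1}"])
       (use x in \<open>auto simp: interpolate_eq[of k, symmetric]\<close>)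
  then show ?thesis by (simp add: k_def)
qed

section \<open>Step functions and the negative binomial mass function\<close>

lemma nn_integral_floor_step:
  fixes G :: "nat \<Rightarrow> ennreal"
  assumes A [measurable]: "A \<in> sets borel"
  shows "(\<integral>\<^sup>+x. (if x < 0 then 0 else G (nat \<lfloor>x\<rfloor>)) * indicator A x \<partial>lborel)
           = (\<Sum>k. G k * emeasure lborel ({real k..<real k + 1} \<inter> A))"
proof -
  have "(if x < 0 then 0 else G (nat \<lfloor>x\<rfloor>)) * indicator A x
          = (\<Sum>k. G k * indicator ({real k..<real k + 1} \<inter> A) x)" for x
  proof (cases "x < 0")
    case True
    then have "G k * indicator ({real k..<real k + 1} \<inter> A) x = 0" for k
      by (auto simp: indicator_def)
    then show ?thesis using True by simp
  next
    case False
    have "x \<in> {real k..<real k + 1} \<longleftrightarrow> k = nat \<lfloor>x\<rfloor>" for k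
      using False by (auto simp: le_floor_iff) linarith+
    then have "G k * indicator ({real k..<real k + 1} \<inter> A) x
        = (if k = nat \<lfloor>x\<rfloor> then G (nat \<lfloor>x\<rfloor>) * indicator A x else 0)" for k
      by (auto simp: indicator_def)
    then have "(\<Sum>k. G k * indicator ({real k..<real k + 1} \<inter> A) x)
        = (\<Sum>k. if k = nat \<lfloor>x\<rfloor> then G (nat \<lfloor>x\<rfloor>) * indicator A x else 0)"
      by presburger
    also have "\<dots> = G (nat \<lfloor>x\<rfloor>) * indicator A x"
      by (rule sums_unique[symmetric, OF sums_single])
    finally show ?thesis using False by simp
  qed
  then have "(\<integral>\<^sup>+x. (if x < 0 then 0 else G (nat \<lfloor>x\<rfloor>)) * indicator A x \<partial>lborel)
      = (\<integral>\<^sup>+x. (\<Sum>k. G k * indicator ({real k..<real k + 1} \<inter> A) x) \<partial>lborel)"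
    by simp
  also have "\<dots> = (\<Sum>k. \<integral>\<^sup>+x. G k * indicator ({real k..<real k + 1} \<inter> A) x \<partial>lborel)"
    by (rule nn_integral_suminf) simp
  also have "\<dots> = (\<Sum>k. G k * emeasure lborel ({real k..<real k + 1} \<inter> A))"
    by (simp add: nn_integral_cmult_indicator)
  finally show ?thesis .
qed

text \<open>The extension by zero keeps the recurrence of the mass function valid on all integers, including
  the step from \<open>-1\<close> to \<open>0\<close>, so that sums over all integers have no boundary terms.\<close>

definition negbin_ext :: "real \<Rightarrow> real \<Rightarrow> int \<Rightarrow> real" where
  "negbin_ext r p k = (if k < 0 then 0 else neg_binomial_density r p (nat k))"

lemma neg_binomial_density_nonneg:
  assumes "r > 0" "0 < p" "p < 1"
  shows "neg_binomial_density r p k \<ge> 0"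
  unfolding neg_binomial_density_def using assms
  by (intro mult_nonneg_nonneg divide_nonneg_nonneg less_imp_le[OF Gamma_real_pos]) auto

lemma neg_binomial_density_Suc:
  assumes "r > 0"
  shows "(real k + 1) * neg_binomial_density r p (Suc k) = p * (r + real k) * neg_binomial_density r p k"
proof -
  have "Gamma (r + real k + 1) = (r + real k) * Gamma (r + real k)"
    using assms by (intro Gamma_plus1) (auto elim!: nonpos_Ints_cases)
  moreover have "Gamma r > 0" using assms by (rule Gamma_real_pos)
  moreover have "r + real (Suc k) = r + real k + 1" by simp
  moreover have "real k + 1 \<noteq> 0" by linarith
  ultimately show ?thesis
    unfolding neg_binomial_density_def
    by (simp add: divide_simps del: of_nat_Suc) (simp add: algebra_simps)
qed

lemma negbin_ext_nonneg:
  assumes "r > 0" "0 < p" "p < 1"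
  shows "negbin_ext r p k \<ge> 0"
  using neg_binomial_density_nonneg[OF assms] by (simp add: negbin_ext_def)

lemma negbin_ext_rec:
  assumes "r > 0"
  shows "(of_int k + 1) * negbin_ext r p (k + 1) = p * (r + of_int k) * negbin_ext r p k"
proof (cases "k < 0")
  case True
  then consider "k = -1" | "k < -1" by linarith
  then show ?thesis by cases (auto simp: negbin_ext_def)
next
  case False
  then have "nat (k + 1) = Suc (nat k)" by simp
  then show ?thesis
    using False neg_binomial_density_Suc[OF assms, of "nat k" p] by (simp add: negbin_ext_def)
qed

lemma negbin_ext_floor_measurable [measurable]:
  "(\<lambda>x::real. negbin_ext r p \<lfloor>x\<rfloor>) \<in> borel_measurable borel"
  "(\<lambda>x::real. negbin_ext r p (\<lfloor>x\<rfloor> + 1)) \<in> borel_measurable borel"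
  by measurable

lemma nn_integral_nat_floor:
  fixes f :: "real \<Rightarrow> real"
  assumes "\<And>k. F k \<ge> 0" and "summable F" and "\<And>x. x < 0 \<Longrightarrow> f x = 0" and "\<And>x. x \<ge> 0 \<Longrightarrow> f x = F (nat \<lfloor>x\<rfloor>)"
  shows "(\<integral>\<^sup>+x. ennreal (f x) \<partial>lborel) = ennreal (\<Sum>k. F k)"
proof -
  have "(\<integral>\<^sup>+x. ennreal (f x) \<partial>lborel)
      = (\<integral>\<^sup>+x. (if (x::real) < 0 then 0 else ennreal (F (nat \<lfloor>x\<rfloor>))) * indicator UNIV x \<partial>lborel)"
  proof (rule nn_integral_cong)
    fix x :: real
    show "ennreal (f x) = (if x < 0 then 0 else ennreal (F (nat \<lfloor>x\<rfloor>))) * indicator UNIV x"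
      using assms(3,4)[of x] by (cases "x < 0") auto
  qed
  also have "\<dots> = (\<Sum>k. ennreal (F k))"
    by (subst nn_integral_floor_step) auto
  also have "\<dots> = ennreal (\<Sum>k. F k)"
    using assms by (intro suminf_ennreal2) auto
  finally show ?thesis .
qed

lemma neg_binomial_density_sums:
  assumes "r > 0" "0 < p" "p < 1"
  shows "neg_binomial_density r p sums 1"
proof -
  interpret prob_space "neg_binomial_measure r p"
    using assms by (rule prob_space_neg_binomial_measure)
  have "(\<Sum>k. ennreal (neg_binomial_density r p k)) = 1"
    using emeasure_space_1
    by (simp add: neg_binomial_measure_def emeasure_density nn_integral_count_space_nat)
  moreover from this have summ: "summable (neg_binomial_density r p)"
    using neg_binomial_density_nonneg[OF assms] by (intro summable_suminf_not_top) auto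
  ultimately have "ennreal (\<Sum>k. neg_binomial_density r p k) = 1"
    using suminf_ennreal2[OF neg_binomial_density_nonneg[OF assms] summ] by simp
  then show ?thesis
    using summ by (simp add: sums_iff)
qed

lemma
  assumes "r > 0" "0 < p" "p < 1"
  shows negbin_ext_integrable: "integrable lborel (\<lambda>x::real. negbin_ext r p \<lfloor>x\<rfloor>)"
    and negbin_ext_integral: "(\<integral>x. negbin_ext r p \<lfloor>x::real\<rfloor> \<partial>lborel) = 1"
proof -
  have "(\<integral>\<^sup>+x. ennreal (negbin_ext r p \<lfloor>x::real\<rfloor>) \<partial>lborel) = ennreal 1"
    using nn_integral_nat_floor[of "neg_binomial_density r p" "\<lambda>x. negbin_ext r p \<lfloor>x\<rfloor>"]
      neg_binomial_density_sums[OF assms] neg_binomial_density_nonneg[OF assms]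
    by (simp add: negbin_ext_def sums_iff)
  then show "integrable lborel (\<lambda>x::real. negbin_ext r p \<lfloor>x\<rfloor>)"
      "(\<integral>x. negbin_ext r p \<lfloor>x::real\<rfloor> \<partial>lborel) = 1"
    using negbin_ext_nonneg[OF assms]
    by (subst (asm) nn_integral_eq_integrable; simp)+
qed

lemma neg_binomial_first_moment_summable:
  assumes "r > 0" "0 < p" "p < 1"
  shows "summable (\<lambda>k. real k * neg_binomial_density r p k)"
proof (rule summable_ratio_test)
  show "(1 + p) / 2 < 1" using assms by simp
  fix k assume k: "k \<ge> nat \<lceil>2 * p * r / (1 - p)\<rceil>"
  then have "2 * p * r / (1 - p) \<le> real k" by linarith
  then have "p * (r + real k) \<le> (1 + p) / 2 * real k"
    using assms by (simp add: field_simps)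
  then have "p * (r + real k) * neg_binomial_density r p k \<le> (1 + p) / 2 * real k * neg_binomial_density r p k"
    using neg_binomial_density_nonneg[OF assms] by (rule mult_right_mono)
  moreover have "\<bar>r + real k\<bar> = r + real k" "\<bar>p\<bar> = p" using assms by auto
  ultimately show "norm (real (Suc k) * neg_binomial_density r p (Suc k))
      \<le> (1 + p) / 2 * norm (real k * neg_binomial_density r p k)"
    using neg_binomial_density_nonneg[OF assms] neg_binomial_density_Suc[OF assms(1), of k p]
    by (simp add: abs_mult add.commute)
qed

lemma negbin_ext_first_moment_integrable:
  assumes "r > 0" "0 < p" "p < 1"
  shows "integrable lborel (\<lambda>x::real. of_int \<lfloor>x\<rfloor> * negbin_ext r p \<lfloor>x\<rfloor>)"
proof (rule integrableI_nonneg)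
  show "AE x::real in lborel. 0 \<le> of_int \<lfloor>x\<rfloor> * negbin_ext r p \<lfloor>x\<rfloor>"
    using neg_binomial_density_nonneg[OF assms] by (auto simp: negbin_ext_def)
  have "(\<integral>\<^sup>+x. ennreal (of_int \<lfloor>x::real\<rfloor> * negbin_ext r p \<lfloor>x\<rfloor>) \<partial>lborel)
      = ennreal (\<Sum>k. real k * neg_binomial_density r p k)"
    using neg_binomial_density_nonneg[OF assms] neg_binomial_first_moment_summable[OF assms]
    by (intro nn_integral_nat_floor) (auto simp: negbin_ext_def)
  then show "(\<integral>\<^sup>+x. ennreal (of_int \<lfloor>x::real\<rfloor> * negbin_ext r p \<lfloor>x\<rfloor>) \<partial>lborel) < \<infinity>"
    by simp
qed simp

text \<open>Summation over all integers is invariant under \<open>k \<mapsto> k + 1\<close>; this replaces summation by parts.\<close>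

lemma lborel_shift_one:
  fixes g :: "int \<Rightarrow> real"
  assumes "integrable lborel (\<lambda>x::real. g \<lfloor>x\<rfloor>)"
  shows "integrable lborel (\<lambda>x::real. g (\<lfloor>x\<rfloor> + 1))"
    and "(\<integral>x. g (\<lfloor>x::real\<rfloor> + 1) \<partial>lborel) = (\<integral>x. g \<lfloor>x::real\<rfloor> \<partial>lborel)"
proof -
  have *: "\<lfloor>1 + 1 * x\<rfloor> = \<lfloor>x\<rfloor> + 1" for x :: real
    using floor_add_int[of x 1] by (simp add: add.commute)
  show "integrable lborel (\<lambda>x::real. g (\<lfloor>x\<rfloor> + 1))"
    using lborel_integrable_real_affine[OF assms, of 1 1] unfolding * by simp
  show "(\<integral>x. g (\<lfloor>x::real\<rfloor> + 1) \<partial>lborel) = (\<integral>x. g \<lfloor>x::real\<rfloor> \<partial>lborel)"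
    using lborel_integral_real_affine[of 1 "\<lambda>x. g \<lfloor>x\<rfloor>" 1] unfolding * by simp
qed

section \<open>Smearing and rounding\<close>

lemma bind_uniform_neg_binomial:
  assumes "r > 0" "0 < p" "p < 1"
  shows "neg_binomial_measure r p \<bind> (\<lambda>k. uniform_measure lborel {real k..<real k + 1})
           = density lborel (\<lambda>x::real. negbin_ext r p \<lfloor>x\<rfloor>)" (is "?B = ?R")
proof (rule measure_eqI)
  let ?M = "neg_binomial_measure r p" and ?T = "\<lambda>k. uniform_measure lborel {real k..<real k + 1}"
  have prob: "prob_space (?T k)" for k :: nat
    by (rule prob_space_uniform_measure) auto
  then have T: "?T \<in> ?M \<rightarrow>\<^sub>M subprob_algebra borel"
    by (auto simp: neg_binomial_measure_def space_subprob_algebra prob_space_imp_subprob_space)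
  have ne: "space ?M \<noteq> {}" by (simp add: neg_binomial_measure_def)
  show sets: "sets ?B = sets ?R"
    using sets_bind[of ?M ?T borel] ne by simp
  fix X assume "X \<in> sets ?B"
  then have [measurable]: "X \<in> sets borel" using sets by simp
  have "emeasure ?B X = (\<integral>\<^sup>+k. emeasure (?T k) X \<partial>?M)"
    using ne T by (rule emeasure_bind) simp
  also have "\<dots> = (\<Sum>k. ennreal (neg_binomial_density r p k) * emeasure lborel ({real k..<real k + 1} \<inter> X))"
    by (simp add: neg_binomial_measure_def nn_integral_density nn_integral_count_space_nat
        divide_ennreal_def)
  also have "\<dots> = (\<integral>\<^sup>+x. (if (x::real) < 0 then 0 else ennreal (neg_binomial_density r p (nat \<lfloor>x\<rfloor>))) * indicator X x \<partial>lborel)"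
    by (rule nn_integral_floor_step[symmetric]) simp
  also have "\<dots> = emeasure ?R X"
    by (subst emeasure_density) (auto intro!: nn_integral_cong simp: negbin_ext_def)
  finally show "emeasure ?B X = emeasure ?R X" .
qed

text \<open>Rounding down recovers an integer from any point of its cell, so it inverts the smearing.\<close>

lemma distr_floor_negbin_ext:
  assumes "r > 0" "0 < p" "p < 1"
  shows "distr (density lborel (\<lambda>x::real. negbin_ext r p \<lfloor>x\<rfloor>)) (count_space UNIV) (\<lambda>x. nat \<lfloor>x\<rfloor>)
           = neg_binomial_measure r p" (is "?L = ?M")
proof (rule measure_eqI_countable)
  fix k :: nat
  let ?A = "(\<lambda>x::real. nat \<lfloor>x\<rfloor>) -` {k}"
  have [measurable]: "?A \<in> sets borel"
    using measurable_sets[of "\<lambda>x::real. nat \<lfloor>x\<rfloor>" borel "count_space UNIV" "{k}"] by simp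
  have "emeasure ?L {k} = (\<integral>\<^sup>+x. (if (x::real) < 0 then 0 else ennreal (neg_binomial_density r p (nat \<lfloor>x\<rfloor>))) * indicator ?A x \<partial>lborel)"
    by (subst emeasure_distr, simp, simp, subst emeasure_density)
       (auto intro!: nn_integral_cong simp: negbin_ext_def)
  also have "\<dots> = (\<integral>\<^sup>+x. (if (x::real) < 0 then 0 else (\<lambda>j. if j = k then ennreal (neg_binomial_density r p j) else 0) (nat \<lfloor>x\<rfloor>)) * indicator UNIV x \<partial>lborel)"
    by (intro nn_integral_cong) (auto simp: indicator_def)
  also have "\<dots> = (\<Sum>j. if j = k then ennreal (neg_binomial_density r p j) else 0)"
    by (subst nn_integral_floor_step) auto
  also have "\<dots> = ennreal (neg_binomial_density r p k)"
    by (rule sums_unique[symmetric, OF sums_single])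
  also have "\<dots> = emeasure ?M {k}"
    by (simp add: neg_binomial_measure_def emeasure_density)
  finally show "emeasure ?L {k} = emeasure ?M {k}" .
qed (auto simp: neg_binomial_measure_def)

section \<open>Increments of the negative binomial mass function\<close>

text \<open>The centre \<open>m - 1 / q\<close> of \<open>u\<close> is the point at which the ratio \<open>P (k + 1) / P k\<close> equals \<open>1\<close>: the
  recurrence gives \<open>(k + 1) d k = (p r - q k - 1) P k\<close>, and \<open>p r - q k - 1 = - q * u k\<close>.\<close>

lemma negbin_increment_identity:
  assumes "r > 0" "0 < p" "p < 1" "q = 1 - p" "m = r * p / q"
  defines "d k \<equiv> negbin_ext r p (k + 1) - negbin_ext r p k"
    and "u k \<equiv> of_int k - m + 1 / q"
  shows "(of_int k + 1) * d k = - (q * u k * negbin_ext r p k)"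
proof -
  have "(of_int k + 1) * d k
      = p * (r + of_int k) * negbin_ext r p k - (of_int k + 1) * negbin_ext r p k"
    using negbin_ext_rec[OF assms(1), of k p] by (simp add: d_def right_diff_distrib)
  also have "\<dots> = - ((q * of_int k - r * p + 1) * negbin_ext r p k)"
    unfolding assms(4) by (simp add: algebra_simps)
  also have "q * of_int k - r * p + 1 = q * u k"
  proof -
    have "q \<noteq> 0" using assms by simp
    then show ?thesis by (simp add: u_def \<open>m = r * p / q\<close> right_diff_distrib distrib_left)
  qed
  finally show ?thesis by simp
qed

text \<open>For \<open>k \<ge> 0\<close> this is unimodality, read off from the identity above. At \<open>k = -1\<close> the increment is
  \<open>P 0 > 0\<close> while \<open>u (-1) = (1 - r) p / q\<close>; this is the point at which \<open>r \<ge> 1\<close> is used.\<close>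

lemma negbin_increment_sign:
  assumes "r \<ge> 1" "0 < p" "p < 1" "q = 1 - p" "m = r * p / q"
  defines "d k \<equiv> negbin_ext r p (k + 1) - negbin_ext r p k"
    and "u k \<equiv> of_int k - m + 1 / q"
  shows "u k * d k \<le> 0"
proof -
  have r: "r > 0" and q: "q > 0" using assms by auto
  have nonneg: "negbin_ext r p j \<ge> 0" for j
    using r assms(2,3) by (rule negbin_ext_nonneg)
  consider "k \<ge> 0" | "k = -1" | "k < -1" by linarith
  then show ?thesis
  proof cases
    case 1
    have "(of_int k + 1) * (u k * d k) = u k * ((of_int k + 1) * d k)"
      by simp
    also have "(of_int k + 1) * d k = - (q * u k * negbin_ext r p k)"
      unfolding d_def u_def by (rule negbin_increment_identity[OF r assms(2-5)])
    also have "u k * - (q * u k * negbin_ext r p k) = - (q * (u k)\<^sup>2 * negbin_ext r p k)"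
      by (simp add: power2_eq_square)
    also have "\<dots> \<le> 0" using q nonneg by simp
    finally show ?thesis using 1 by (simp add: mult_le_0_iff)
  next
    case 2
    have "u k = (1 - r) * p / q"
      using 2 q assms(4,5) by (simp add: u_def field_simps)
    then have "u k \<le> 0" using assms q by (simp add: divide_nonpos_pos mult_nonpos_nonneg)
    moreover have "d k \<ge> 0" using 2 nonneg[of 0] by (simp add: d_def negbin_ext_def)
    ultimately show ?thesis by (simp add: mult_nonpos_nonneg)
  next
    case 3
    then show ?thesis by (simp add: d_def negbin_ext_def)
  qed
qed

text \<open>
  With \<open>g k = (k - m + 1 / q - 1) * P k\<close> one has \<open>u k * d k = g (k + 1) - g k - P k\<close>. By the sign lemma
  \<open>\<bar>u d\<bar> = - u d\<close>, and the two terms in \<open>g\<close> cancel under the integral by translation invariance.\<close>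

lemma
  assumes "r \<ge> 1" "0 < p" "p < 1" "q = 1 - p" "m = r * p / q"
  defines "d k \<equiv> negbin_ext r p (k + 1) - negbin_ext r p k"
    and "u k \<equiv> of_int k - m + 1 / q"
  shows negbin_weighted_variation_integrable: "integrable lborel (\<lambda>x::real. \<bar>u \<lfloor>x\<rfloor> * d \<lfloor>x\<rfloor>\<bar>)"
    and negbin_weighted_variation: "(\<integral>x. \<bar>u \<lfloor>x::real\<rfloor> * d \<lfloor>x\<rfloor>\<bar> \<partial>lborel) = 1"
proof -
  have r: "r > 0" using assms by auto
  define s where "s = negbin_ext r p"
  define g where "g k = (of_int k - m + 1 / q - 1) * s k" for k
  have s: "integrable lborel (\<lambda>x::real. s \<lfloor>x\<rfloor>)" "(\<integral>x. s \<lfloor>x::real\<rfloor> \<partial>lborel) = 1"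
    using negbin_ext_integrable[OF r assms(2,3)] negbin_ext_integral[OF r assms(2,3)]
    by (auto simp: s_def)
  have g: "integrable lborel (\<lambda>x::real. g \<lfloor>x\<rfloor>)"
  proof -
    have "integrable lborel (\<lambda>x::real. of_int \<lfloor>x\<rfloor> * s \<lfloor>x\<rfloor> + (1 / q - 1 - m) * s \<lfloor>x\<rfloor>)"
      using negbin_ext_first_moment_integrable[OF r assms(2,3)] s
      by (intro Bochner_Integration.integrable_add integrable_mult_right) (auto simp: s_def)
    then show ?thesis by (simp add: g_def algebra_simps)
  qed
  note g' = lborel_shift_one[OF g]
  have eq: "\<bar>u k * d k\<bar> = s k - (g (k + 1) - g k)" for k
    using negbin_increment_sign[OF assms(1-5), of k]
    by (simp add: abs_of_nonpos g_def u_def d_def s_def algebra_simps)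
  show "integrable lborel (\<lambda>x::real. \<bar>u \<lfloor>x\<rfloor> * d \<lfloor>x\<rfloor>\<bar>)"
    using s g g' by (simp add: eq)
  show "(\<integral>x. \<bar>u \<lfloor>x::real\<rfloor> * d \<lfloor>x\<rfloor>\<bar> \<partial>lborel) = 1"
    using s g g' by (simp add: eq)
qed

text \<open>The left-hand side measures how far \<open>P\<close> is from satisfying the difference equation
  \<open>d k = - (k - m) / v * P k\<close> (note \<open>1 / v = q / m\<close>). Multiplied by \<open>m\<close>, the increment identity turns
  it into \<open>p / q * d k - u k * d k - P k\<close>, each term of which has bounded sum, so the total defect is
  \<open>O(1 / m)\<close>.\<close>

lemma negbin_stein_defect_bound:
  assumes "r \<ge> 1" "0 < p" "p < 1" "q = 1 - p" "m = r * p / q"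
  defines "d k \<equiv> negbin_ext r p (k + 1) - negbin_ext r p k"
    and "u k \<equiv> of_int k - m + 1 / q"
  shows "\<bar>d k + q * (of_int k - m) / m * negbin_ext r p k\<bar>
           \<le> (\<bar>u k * d k\<bar> + p / q * \<bar>d k\<bar> + negbin_ext r p k) / m"
proof -
  have r: "r > 0" and q: "q > 0" and m: "m > 0" using assms by auto
  define s where "s = negbin_ext r p k"
  have s0: "s \<ge> 0" unfolding s_def using r assms(2,3) by (rule negbin_ext_nonneg)
  have id: "(of_int k + 1) * d k = - (q * u k * s)"
    using negbin_increment_identity[OF r assms(2-5), of k] by (simp add: d_def u_def s_def)
  have k: "of_int k = u k + m - 1 / q" by (simp add: u_def)
  have pq: "p / q = 1 / q - 1" using q assms(4) by (simp add: field_simps)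
  have qu: "q * (of_int k - m) * s = q * u k * s - s"
    unfolding k using q by (simp add: field_simps)
  have "m * (d k + q * (of_int k - m) / m * s) = m * d k + q * (of_int k - m) * s"
    using m by (simp add: field_simps)
  also have "\<dots> = m * d k - (of_int k + 1) * d k - s"
    unfolding id qu by simp
  also have "\<dots> = p / q * d k - u k * d k - s"
    unfolding k pq by (simp add: algebra_simps)
  finally have "m * \<bar>d k + q * (of_int k - m) / m * s\<bar> = \<bar>p / q * d k - u k * d k - s\<bar>"
    using m by (metis abs_mult abs_of_pos)
  also have "\<dots> \<le> \<bar>u k * d k\<bar> + p / q * \<bar>d k\<bar> + s"
  proof -
    have "\<bar>p / q * d k\<bar> = p / q * \<bar>d k\<bar>" using assms(2) q by (simp add: abs_mult)
    moreover have "\<bar>a - b - c\<bar> \<le> \<bar>b\<bar> + \<bar>a\<bar> + c" if "c \<ge> 0" for a b c :: real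
      using that by linarith
    from this[OF s0, of "p / q * d k" "u k * d k"]
    have "\<bar>p / q * d k - u k * d k - s\<bar> \<le> \<bar>u k * d k\<bar> + \<bar>p / q * d k\<bar> + s" .
    ultimately show ?thesis by simp
  qed
  finally show ?thesis using m by (simp add: s_def field_simps)
qed

text \<open>The total variation of \<open>P\<close> is of the order of its maximum. Far from the centre, where
  \<open>\<bar>u\<bar> \<ge> L\<close>, it is at most \<open>1 / L\<close> because \<open>\<integral>\<bar>u d\<bar> = 1\<close>; near the centre the difference
  equation gives \<open>\<bar>d\<bar> \<le> L / v * P\<close> up to lower order terms, hence a contribution \<open>O(L / r)\<close>. The
  choice \<open>L = sqrt r\<close> balances the two. The bound by \<open>2\<close> comes first and is
  used to absorb the term \<open>p / q * \<bar>d\<bar>\<close> of the defect.\<close>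

lemma negbin_variation_bound:
  assumes "r \<ge> 1" "0 < p" "p < 1" "q = 1 - p"
  defines "d k \<equiv> negbin_ext r p (k + 1) - negbin_ext r p k"
  shows "integrable lborel (\<lambda>x::real. \<bar>d \<lfloor>x\<rfloor>\<bar>)"
    and "(\<integral>x. \<bar>d \<lfloor>x::real\<rfloor>\<bar> \<partial>lborel) \<le> 2"
    and "(\<integral>x. \<bar>d \<lfloor>x::real\<rfloor>\<bar> \<partial>lborel) \<le> (1 + (3 + 2 * p / q) * q / p + q\<^sup>2 / p) / sqrt r"
proof -
  have r: "r > 0" and q: "q > 0" using assms by auto
  define m where "m = r * p / q"
  have m: "m > 0" using r q assms by (simp add: m_def)
  define u where "u k = of_int k - m + 1 / q" for k
  define s where "s = negbin_ext r p"
  have s: "integrable lborel (\<lambda>x::real. s \<lfloor>x\<rfloor>)" "(\<integral>x. s \<lfloor>x::real\<rfloor> \<partial>lborel) = 1"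
    using negbin_ext_integrable[OF r assms(2,3)] negbin_ext_integral[OF r assms(2,3)]
    by (auto simp: s_def)
  have s0: "s k \<ge> 0" for k unfolding s_def using r assms(2,3) by (rule negbin_ext_nonneg)
  note s' = lborel_shift_one[OF s(1)]
  have ud: "integrable lborel (\<lambda>x::real. \<bar>u \<lfloor>x\<rfloor> * d \<lfloor>x\<rfloor>\<bar>)" "(\<integral>x. \<bar>u \<lfloor>x::real\<rfloor> * d \<lfloor>x\<rfloor>\<bar> \<partial>lborel) = 1"
    using negbin_weighted_variation_integrable[OF assms(1-4) m_def]
      negbin_weighted_variation[OF assms(1-4) m_def]
    by (auto simp: u_def d_def)
  have "integrable lborel (\<lambda>x::real. d \<lfloor>x\<rfloor>)"
    using s s' by (simp add: d_def s_def)
  then show d: "integrable lborel (\<lambda>x::real. \<bar>d \<lfloor>x\<rfloor>\<bar>)" by simp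
  have "(\<integral>x. \<bar>d \<lfloor>x::real\<rfloor>\<bar> \<partial>lborel) \<le> (\<integral>x. s (\<lfloor>x::real\<rfloor> + 1) + s \<lfloor>x\<rfloor> \<partial>lborel)"
  proof (rule integral_mono[OF d])
    show "\<bar>d \<lfloor>x\<rfloor>\<bar> \<le> s (\<lfloor>x\<rfloor> + 1) + s \<lfloor>x\<rfloor>" for x :: real
      using s0[of "\<lfloor>x\<rfloor>"] s0[of "\<lfloor>x\<rfloor> + 1"] by (simp add: d_def s_def)
  qed (use s s' in auto)
  also have "\<dots> = 2" using s s' by simp
  finally show V2: "(\<integral>x. \<bar>d \<lfloor>x::real\<rfloor>\<bar> \<partial>lborel) \<le> 2" .
  define L where "L = sqrt r"
  have L: "L \<ge> 1" "L * L = r" using assms by (auto simp: L_def)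
  have ptw: "\<bar>d k\<bar> \<le> \<bar>u k * d k\<bar> / L + (\<bar>u k * d k\<bar> + p / q * \<bar>d k\<bar> + s k) / m + q / m * (L + 1 / q) * s k" for k
  proof (cases "\<bar>u k\<bar> \<ge> L")
    case True
    then have "L * \<bar>d k\<bar> \<le> \<bar>u k * d k\<bar>" by (simp add: abs_mult mult_right_mono)
    then have "\<bar>d k\<bar> \<le> \<bar>u k * d k\<bar> / L" using L by (simp add: field_simps)
    moreover have "0 \<le> (\<bar>u k * d k\<bar> + p / q * \<bar>d k\<bar> + s k) / m" "0 \<le> q / m * (L + 1 / q) * s k"
      using m q L assms(2) s0[of k] by auto
    ultimately show ?thesis by linarith
  next
    case False
    have "\<bar>d k\<bar> \<le> \<bar>d k + q * (of_int k - m) / m * s k\<bar> + \<bar>q * (of_int k - m) / m * s k\<bar>"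
      using abs_triangle_ineq4[of "d k + q * (of_int k - m) / m * s k" "q * (of_int k - m) / m * s k"] by simp
    moreover have "\<bar>d k + q * (of_int k - m) / m * s k\<bar> \<le> (\<bar>u k * d k\<bar> + p / q * \<bar>d k\<bar> + s k) / m"
      using negbin_stein_defect_bound[OF assms(1-4) m_def, of k] by (simp add: d_def u_def s_def)
    moreover have "\<bar>q * (of_int k - m) / m * s k\<bar> \<le> q / m * (L + 1 / q) * s k"
    proof -
      have "\<bar>of_int k - m\<bar> \<le> L + 1 / q"
        using False q by (simp add: u_def abs_if split: if_splits) (use divide_pos_pos[OF zero_less_one q] in linarith)+
      then have "q / m * \<bar>of_int k - m\<bar> * s k \<le> q / m * (L + 1 / q) * s k"
        using q m s0[of k] by (intro mult_right_mono mult_left_mono) auto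
      then show ?thesis using q m s0[of k] by (simp add: abs_mult)
    qed
    moreover have "\<bar>u k * d k\<bar> / L \<ge> 0" using L by simp
    ultimately show ?thesis by linarith
  qed
  have "(\<integral>x. \<bar>d \<lfloor>x::real\<rfloor>\<bar> \<partial>lborel)
     \<le> (\<integral>x. \<bar>u \<lfloor>x::real\<rfloor> * d \<lfloor>x\<rfloor>\<bar> / L + (\<bar>u \<lfloor>x\<rfloor> * d \<lfloor>x\<rfloor>\<bar> + p / q * \<bar>d \<lfloor>x\<rfloor>\<bar> + s \<lfloor>x\<rfloor>) / m
           + q / m * (L + 1 / q) * s \<lfloor>x\<rfloor> \<partial>lborel)"
    by (rule integral_mono[OF d _ ptw]) (use d ud(1) s(1) in simp)
  also have "\<dots> = 1 / L + (1 + p / q * (\<integral>x. \<bar>d \<lfloor>x::real\<rfloor>\<bar> \<partial>lborel) + 1) / m + q / m * (L + 1 / q)"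
    using d ud s by simp
  also have "\<dots> \<le> 1 / L + (1 + p / q * 2 + 1) / m + q / m * (L + 1 / q)"
    using V2 m q assms(2) by (intro add_mono divide_right_mono mult_left_mono order_refl) auto
  also have "\<dots> = 1 / L + (3 + 2 * p / q) * q / p / r + q\<^sup>2 / p * (L / r)"
    using q r assms(2) by (simp add: m_def field_simps power2_eq_square)
  also have "\<dots> \<le> 1 / L + (3 + 2 * p / q) * q / p / L + q\<^sup>2 / p * (1 / L)"
  proof -
    have "L \<le> r" using L mult_left_mono[of 1 L L] by simp
    moreover have "L / r = 1 / L" using L by (auto simp: field_simps)
    ultimately show ?thesis
      using L q assms(2) by (intro add_mono order_refl divide_left_mono) auto
  qed
  also have "\<dots> = (1 + (3 + 2 * p / q) * q / p + q\<^sup>2 / p) / L"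
    by (simp add: add_divide_distrib)
  finally show "(\<integral>x. \<bar>d \<lfloor>x::real\<rfloor>\<bar> \<partial>lborel) \<le> (1 + (3 + 2 * p / q) * q / p + q\<^sup>2 / p) / sqrt r"
    by (simp add: L_def)
qed

section \<open>Distance to the normal density\<close>

text \<open>The left-hand side is the inhomogeneity \<open>h\<close> of the Gaussian equation for the interpolation, with
  \<open>v\<close> written as \<open>m / q\<close>. On the cell of \<open>k\<close>, at offset \<open>t\<close>, it is the discrete defect plus
  \<open>q / m\<close> times terms of the size of \<open>P k\<close>, \<open>u k * d k\<close> and \<open>d k\<close>.\<close>

lemma negbin_interpolation_defect_bound:
  fixes x :: real
  assumes "r \<ge> 1" "0 < p" "p < 1" "q = 1 - p" "m = r * p / q"
  defines "d k \<equiv> negbin_ext r p (k + 1) - negbin_ext r p k"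
    and "u k \<equiv> of_int k - m + 1 / q"
  shows "\<bar>d \<lfloor>x\<rfloor> + (x - m) / (m / q) * interpolate (negbin_ext r p) x\<bar>
           \<le> (2 * \<bar>u \<lfloor>x\<rfloor> * d \<lfloor>x\<rfloor>\<bar> + 2 * negbin_ext r p \<lfloor>x\<rfloor> + (1 / q + q) * \<bar>d \<lfloor>x\<rfloor>\<bar>) / m"
proof -
  have r: "r > 0" and q: "0 < q" "q < 1" and m: "m > 0" using assms by auto
  define k where "k = \<lfloor>x\<rfloor>"
  define t where "t = x - of_int k"
  define s where "s = negbin_ext r p k"
  have t: "0 \<le> t" "t \<le> 1" unfolding t_def k_def by linarith+
  have s0: "s \<ge> 0" unfolding s_def using r assms(2,3) by (rule negbin_ext_nonneg)
  have f: "interpolate (negbin_ext r p) x = s + t * d k"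
    by (simp add: interpolate_def s_def t_def k_def d_def)
  have x: "x = of_int k + t" by (simp add: t_def)
  let ?D = "d k + q * (of_int k - m) / m * s"
  have abs_add4: "\<bar>a + b + c + e\<bar> \<le> \<bar>a\<bar> + \<bar>b\<bar> + \<bar>c\<bar> + \<bar>e\<bar>" for a b c e :: real
    by linarith
  have "m * (d k + (x - m) / (m / q) * (s + t * d k))
      = m * ?D + q * (t * s) + q * t * ((of_int k - m) * d k) + q * (t * t) * d k"
    using m unfolding x by (simp add: field_simps)
  also have "\<bar>\<dots>\<bar> \<le> \<bar>m * ?D\<bar> + \<bar>q * (t * s)\<bar> + \<bar>q * t * ((of_int k - m) * d k)\<bar> + \<bar>q * (t * t) * d k\<bar>"
    by (rule abs_add4)
  also have "\<dots> \<le> (\<bar>u k * d k\<bar> + p / q * \<bar>d k\<bar> + s) + s + (\<bar>u k * d k\<bar> + \<bar>d k\<bar>) + q * \<bar>d k\<bar>"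
  proof (intro add_mono)
    show "\<bar>m * ?D\<bar> \<le> \<bar>u k * d k\<bar> + p / q * \<bar>d k\<bar> + s"
      using negbin_stein_defect_bound[OF assms(1-5), of k] m
      by (simp add: abs_mult d_def u_def s_def pos_le_divide_eq mult.commute)
    show "\<bar>q * (t * s)\<bar> \<le> s"
    proof -
      have "q * t \<le> 1" using q t by (simp add: mult_le_one)
      then have "(q * t) * s \<le> 1 * s" using s0 by (rule mult_right_mono)
      then show ?thesis using q t s0 by (simp add: abs_mult mult.assoc)
    qed
    show "\<bar>q * t * ((of_int k - m) * d k)\<bar> \<le> \<bar>u k * d k\<bar> + \<bar>d k\<bar>"
    proof -
      have "q * t * ((of_int k - m) * d k) = q * t * (u k * d k) - t * d k"
        using q by (simp add: u_def field_simps)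
      moreover have "\<bar>q * t * (u k * d k)\<bar> \<le> \<bar>u k * d k\<bar>"
      proof -
        have "q * t \<le> 1" using q t by (simp add: mult_le_one)
        then have "\<bar>q * t\<bar> * \<bar>u k * d k\<bar> \<le> 1 * \<bar>u k * d k\<bar>"
          using q t by (intro mult_right_mono) auto
        then show ?thesis by (simp add: abs_mult)
      qed
      moreover have "\<bar>t * d k\<bar> \<le> \<bar>d k\<bar>"
        using t by (simp add: abs_mult mult_left_le_one_le)
      ultimately show ?thesis
        using abs_triangle_ineq4[of "q * t * (u k * d k)" "t * d k"] by linarith
    qed
    show "\<bar>q * (t * t) * d k\<bar> \<le> q * \<bar>d k\<bar>"
    proof -
      have "t * t \<le> 1" using t by (simp add: mult_le_one)
      then have "(t * t) * (q * \<bar>d k\<bar>) \<le> 1 * (q * \<bar>d k\<bar>)" using q by (intro mult_right_mono) auto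
      then show ?thesis using q t by (simp add: abs_mult mult_ac)
    qed
  qed
  also have "\<dots> = 2 * \<bar>u k * d k\<bar> + 2 * s + (1 / q + q) * \<bar>d k\<bar>"
  proof -
    have "p / q = 1 / q - 1" using q assms(4) by (simp add: field_simps)
    then show ?thesis by (simp only:) (simp add: algebra_simps)
  qed
  finally have "m * \<bar>d k + (x - m) / (m / q) * (s + t * d k)\<bar>
      \<le> 2 * \<bar>u k * d k\<bar> + 2 * s + (1 / q + q) * \<bar>d k\<bar>"
    using m by (simp add: abs_mult)
  then show ?thesis
    using m unfolding f by (simp add: k_def s_def pos_le_divide_eq mult.commute)
qed

text \<open>Integrating the defect bound gives \<open>\<integral>\<bar>h\<bar> \<le> (4 + 2 (1 / q + q)) / m \<le> 8 / (q m)\<close>, to which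
  the Gaussian comparison applies with the integers as corners.\<close>

lemma negbin_interpolation_near_gaussian:
  assumes "r \<ge> 1" "0 < p" "p < 1" "q = 1 - p"
  defines "m \<equiv> r * p / q" and "v \<equiv> r * p / q\<^sup>2"
  shows "integrable lborel (interpolate (negbin_ext r p))"
    and "\<exists>c. (\<integral>x. \<bar>interpolate (negbin_ext r p) x - c * normal_density m (sqrt v) x\<bar> \<partial>lborel)
               \<le> sqrt (2 * pi * v) * (8 / (r * p))"
proof -
  have r: "r > 0" and q: "0 < q" "q < 1" and m: "m > 0" using assms by (auto simp: m_def)
  have v: "v = m / q" "v > 0"
    using q r assms(2) by (auto simp: v_def m_def power2_eq_square)
  define d where "d k = negbin_ext r p (k + 1) - negbin_ext r p k" for k
  define u where "u k = of_int k - m + 1 / q" for k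
  define s where "s = negbin_ext r p"
  define f where "f = interpolate s"
  define h where "h x = d \<lfloor>x\<rfloor> + (x - m) / v * f x" for x
  have s: "integrable lborel (\<lambda>x::real. s \<lfloor>x\<rfloor>)" "(\<integral>x. s \<lfloor>x::real\<rfloor> \<partial>lborel) = 1"
    using negbin_ext_integrable[OF r assms(2,3)] negbin_ext_integral[OF r assms(2,3)]
    by (auto simp: s_def)
  have s0: "s k \<ge> 0" for k unfolding s_def using r assms(2,3) by (rule negbin_ext_nonneg)
  have ud: "integrable lborel (\<lambda>x::real. \<bar>u \<lfloor>x\<rfloor> * d \<lfloor>x\<rfloor>\<bar>)" "(\<integral>x. \<bar>u \<lfloor>x::real\<rfloor> * d \<lfloor>x\<rfloor>\<bar> \<partial>lborel) = 1"
    using negbin_weighted_variation_integrable[OF assms(1-4) meta_eq_to_obj_eq[OF m_def]]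
      negbin_weighted_variation[OF assms(1-4) meta_eq_to_obj_eq[OF m_def]]
    by (auto simp: u_def d_def)
  have d: "integrable lborel (\<lambda>x::real. \<bar>d \<lfloor>x\<rfloor>\<bar>)" "(\<integral>x. \<bar>d \<lfloor>x::real\<rfloor>\<bar> \<partial>lborel) \<le> 2"
    using negbin_variation_bound(1,2)[OF assms(1-4)] by (auto simp: d_def)
  have cont: "continuous_on UNIV f"
    unfolding f_def by (rule continuous_on_interpolate)
  then have [measurable]: "f \<in> borel_measurable borel"
    by (rule borel_measurable_continuous_onI)
  have [measurable]: "(\<lambda>x::real. d \<lfloor>x\<rfloor>) \<in> borel_measurable borel"
    unfolding d_def by measurable
  have "integrable lborel (\<lambda>x::real. s \<lfloor>x\<rfloor> + \<bar>d \<lfloor>x\<rfloor>\<bar>)"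
    using s d by simp
  then have f: "integrable lborel f"
  proof (rule Bochner_Integration.integrable_bound)
    show "AE x in lborel. norm (f x) \<le> norm (s \<lfloor>x\<rfloor> + \<bar>d \<lfloor>x\<rfloor>\<bar>)"
    proof (rule AE_I2)
      fix x :: real
      have "\<bar>(x - \<lfloor>x\<rfloor>) * d \<lfloor>x\<rfloor>\<bar> \<le> \<bar>d \<lfloor>x\<rfloor>\<bar>"
      proof -
        have "0 \<le> x - \<lfloor>x\<rfloor>" "x - \<lfloor>x\<rfloor> \<le> 1" by linarith+
        then show ?thesis by (simp add: abs_mult mult_left_le_one_le)
      qed
      moreover have "f x = s \<lfloor>x\<rfloor> + (x - \<lfloor>x\<rfloor>) * d \<lfloor>x\<rfloor>"
        by (simp add: f_def interpolate_def s_def d_def)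
      ultimately show "norm (f x) \<le> norm (s \<lfloor>x\<rfloor> + \<bar>d \<lfloor>x\<rfloor>\<bar>)"
        using s0[of "\<lfloor>x\<rfloor>"] by simp
    qed
  qed simp
  then show "integrable lborel (interpolate (negbin_ext r p))"
    by (simp add: f_def s_def)
  have [measurable]: "h \<in> borel_measurable borel"
    unfolding h_def by measurable
  define B where "B x = (2 * \<bar>u \<lfloor>x\<rfloor> * d \<lfloor>x\<rfloor>\<bar> + 2 * s \<lfloor>x\<rfloor> + (1 / q + q) * \<bar>d \<lfloor>x\<rfloor>\<bar>) / m" for x :: real
  have B: "integrable lborel B"
    unfolding B_def using ud s d by simp
  have hB: "\<bar>h x\<bar> \<le> B x" for x
    using negbin_interpolation_defect_bound[OF assms(1-4) meta_eq_to_obj_eq[OF m_def], of x]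
    unfolding h_def B_def f_def v(1) s_def d_def u_def .
  have h: "integrable lborel h"
    by (rule Bochner_Integration.integrable_bound[OF B])
       (use hB order_trans[OF hB abs_ge_self] in \<open>auto simp: h_def\<close>)
  have "(\<integral>x. \<bar>h x\<bar> \<partial>lborel) \<le> (\<integral>x. B x \<partial>lborel)"
    using h B hB by (intro integral_mono) auto
  also have "\<dots> = (2 + 2 + (1 / q + q) * (\<integral>x. \<bar>d \<lfloor>x::real\<rfloor>\<bar> \<partial>lborel)) / m"
    unfolding B_def using ud s d by simp
  also have "\<dots> \<le> (2 + 2 + (1 / q + q) * 2) / m"
    using d q m by (intro divide_right_mono add_mono mult_left_mono) auto
  also have "\<dots> \<le> (8 / q) / m"
  proof (rule divide_right_mono)
    have "1 \<le> 1 / q" "q \<le> 1 / q"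
      using q mult_le_one[of q q] by (auto simp: pos_le_divide_eq)
    then show "2 + 2 + (1 / q + q) * 2 \<le> 8 / q" by simp
  qed (use m in simp)
  also have "\<dots> = 8 / (r * p)" using q by (simp add: m_def)
  finally have h8: "(\<integral>x. \<bar>h x\<bar> \<partial>lborel) \<le> 8 / (r * p)" .
  have fin: "finite (\<int> \<inter> {a..b})" for a b :: real
  proof (rule finite_subset)
    show "\<int> \<inter> {a..b} \<subseteq> of_int ` {\<lceil>a\<rceil>..\<lfloor>b\<rfloor>}"
      by (auto elim!: Ints_cases intro!: imageI simp: ceiling_le_iff le_floor_iff)
  qed simp
  have deriv: "(f has_real_derivative (h x - (x - m) / v * f x)) (at x)" if "x \<notin> \<int>" for x
    using interpolate_has_real_derivative[OF that, of s] by (simp add: h_def f_def d_def s_def)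
  obtain c where "(\<integral>x. \<bar>f x - c * normal_density m (sqrt v) x\<bar> \<partial>lborel)
      \<le> sqrt (2 * pi * v) * (\<integral>x. \<bar>h x\<bar> \<partial>lborel)"
    using gaussian_comparison_L1[OF v(2) cont h fin deriv f] by blast
  also have "\<dots> \<le> sqrt (2 * pi * v) * (8 / (r * p))"
    using h8 v(2) by (intro mult_left_mono) auto
  finally show "\<exists>c. (\<integral>x. \<bar>interpolate (negbin_ext r p) x - c * normal_density m (sqrt v) x\<bar> \<partial>lborel)
      \<le> sqrt (2 * pi * v) * (8 / (r * p))"
    unfolding f_def s_def by blast
qed

text \<open>The step density differs from the interpolation by at most \<open>\<bar>d\<bar>\<close> on each cell, which costs
  \<open>C1 / sqrt r\<close>, and the interpolation differs from a multiple of the normal density by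
  \<open>C2 / sqrt r\<close>. The summand \<open>2\<close> of the constant covers \<open>r < 1\<close>.\<close>

lemma negbin_normal_L1_bound:
  assumes "0 < p" "p < 1" "q = 1 - p"
  obtains C where "C > 0"
    "\<And>r. r > 0 \<Longrightarrow> (\<integral>x. \<bar>negbin_ext r p \<lfloor>x\<rfloor> - normal_density (r * p / q) (sqrt (r * p / q\<^sup>2)) x\<bar> \<partial>lborel)
        \<le> C / sqrt r"
proof
  define C1 where "C1 = 1 + (3 + 2 * p / q) * q / p + q\<^sup>2 / p"
  define C2 where "C2 = 8 * sqrt (2 * pi) / (q * sqrt p)"
  have q: "0 < q" "q < 1" using assms by auto
  have C1: "C1 \<ge> 0" using assms(1) q unfolding C1_def by (intro add_nonneg_nonneg) auto
  have C2: "C2 \<ge> 0" using assms(1) q unfolding C2_def by simp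
  show "2 + 2 * (C1 + C2) > 0" using C1 C2 by simp
  fix r :: real assume r: "r > 0"
  define s where "s x = negbin_ext r p \<lfloor>x\<rfloor>" for x :: real
  define \<phi> where "\<phi> = normal_density (r * p / q) (sqrt (r * p / q\<^sup>2))"
  have s: "integrable lborel s" "(\<integral>x. s x \<partial>lborel) = 1" "\<And>x. s x \<ge> 0"
    using negbin_ext_integrable[OF r assms(1,2)] negbin_ext_integral[OF r assms(1,2)]
      negbin_ext_nonneg[OF r assms(1,2)]
    by (auto simp: s_def[abs_def])
  have "sqrt (r * p / q\<^sup>2) > 0" using r assms(1) q by simp
  then have \<phi>: "integrable lborel \<phi>" "(\<integral>x. \<phi> x \<partial>lborel) = 1" "\<And>x. \<phi> x \<ge> 0"
    by (auto simp: \<phi>_def normal_density_nonneg)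
  have "(\<integral>x. \<bar>s x - \<phi> x\<bar> \<partial>lborel) \<le> (2 + 2 * (C1 + C2)) / sqrt r"
  proof (cases "r \<ge> 1")
    case False
    have "(\<integral>x. \<bar>s x - \<phi> x\<bar> \<partial>lborel) \<le> (\<integral>x. s x + \<phi> x \<partial>lborel)"
    proof (rule integral_mono)
      show "\<bar>s x - \<phi> x\<bar> \<le> s x + \<phi> x" for x using s(3)[of x] \<phi>(3)[of x] by simp
    qed (use s \<phi> in auto)
    also have "\<dots> = 2" using s \<phi> by simp
    also have "\<dots> \<le> 2 + 2 * (C1 + C2)" using C1 C2 by simp
    also have "\<dots> \<le> (2 + 2 * (C1 + C2)) / sqrt r"
      using False r C1 C2 by (simp add: pos_le_divide_eq mult_left_le)
    finally show ?thesis .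
  next
    case True
    define f where "f = interpolate (negbin_ext r p)"
    define d where "d k = negbin_ext r p (k + 1) - negbin_ext r p k" for k
    have f: "integrable lborel f"
      unfolding f_def by (rule negbin_interpolation_near_gaussian(1)[OF True assms])
    obtain c where c: "(\<integral>x. \<bar>f x - c * \<phi> x\<bar> \<partial>lborel) \<le> sqrt (2 * pi * (r * p / q\<^sup>2)) * (8 / (r * p))"
      using negbin_interpolation_near_gaussian(2)[OF True assms] unfolding f_def \<phi>_def by blast
    have "sqrt (2 * pi * (r * p / q\<^sup>2)) * (8 / (r * p)) = C2 / sqrt r"
    proof -
      have 1: "sqrt (2 * pi * (r * p / q\<^sup>2)) = sqrt (2 * pi) * (sqrt r * sqrt p) / q"
        using q by (simp add: real_sqrt_mult real_sqrt_divide)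
      have 2: "8 / (r * p) = 8 / (sqrt r * sqrt p) / (sqrt r * sqrt p)"
        using r assms(1) by (simp add: mult_ac flip: real_sqrt_mult)
      show ?thesis
        unfolding 1 2 C2_def using r assms(1) q by (simp add: field_simps)
    qed
    with c have fc: "(\<integral>x. \<bar>f x - c * \<phi> x\<bar> \<partial>lborel) \<le> C2 / sqrt r" by simp
    have d: "integrable lborel (\<lambda>x::real. \<bar>d \<lfloor>x\<rfloor>\<bar>)" "(\<integral>x. \<bar>d \<lfloor>x::real\<rfloor>\<bar> \<partial>lborel) \<le> C1 / sqrt r"
      using negbin_variation_bound(1,3)[OF True assms] by (auto simp: d_def C1_def)
    have "(\<integral>x. \<bar>s x - c * \<phi> x\<bar> \<partial>lborel) \<le> (\<integral>x. \<bar>d \<lfloor>x\<rfloor>\<bar> + \<bar>f x - c * \<phi> x\<bar> \<partial>lborel)"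
    proof (rule integral_mono)
      fix x :: real
      have "0 \<le> x - \<lfloor>x\<rfloor>" "x - \<lfloor>x\<rfloor> \<le> 1" by linarith+
      then have "\<bar>(x - \<lfloor>x\<rfloor>) * d \<lfloor>x\<rfloor>\<bar> \<le> \<bar>d \<lfloor>x\<rfloor>\<bar>"
        by (simp add: abs_mult mult_left_le_one_le)
      moreover have "f x = s x + (x - \<lfloor>x\<rfloor>) * d \<lfloor>x\<rfloor>"
        by (simp add: f_def interpolate_def s_def d_def)
      ultimately show "\<bar>s x - c * \<phi> x\<bar> \<le> \<bar>d \<lfloor>x\<rfloor>\<bar> + \<bar>f x - c * \<phi> x\<bar>" by linarith
    qed (use s f \<phi> d in auto)
    also have "\<dots> \<le> C1 / sqrt r + C2 / sqrt r"
      using d f \<phi> fc by (subst Bochner_Integration.integral_add) auto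
    finally have "2 * (\<integral>x. \<bar>s x - c * \<phi> x\<bar> \<partial>lborel) \<le> 2 * (C1 / sqrt r + C2 / sqrt r)"
      by (intro mult_left_mono) auto
    then have "(\<integral>x. \<bar>s x - \<phi> x\<bar> \<partial>lborel) \<le> 2 * (C1 / sqrt r + C2 / sqrt r)"
      by (rule order_trans[OF L1_dist_le_of_scaled[OF s(1) \<phi>(1) s(2) \<phi>(2,3), of c]])
    also have "\<dots> \<le> (2 + 2 * (C1 + C2)) / sqrt r"
      using r by (simp add: add_divide_distrib)
    finally show ?thesis .
  qed
  then show "(\<integral>x. \<bar>negbin_ext r p \<lfloor>x\<rfloor> - normal_density (r * p / q) (sqrt (r * p / q\<^sup>2)) x\<bar> \<partial>lborel)
      \<le> (2 + 2 * (C1 + C2)) / sqrt r"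
    by (simp add: s_def \<phi>_def)
qed

section \<open>The Le Cam distance\<close>

lemma deficiency_leI:
  assumes "T \<in> M \<rightarrow>\<^sub>M prob_algebra N" and "\<And>i. i \<in> I \<Longrightarrow> tv_norm_diff (Giry_Monad.bind (P i) T) (Q i) \<le> e"
  shows "deficiency M N I P Q \<le> e"
  unfolding deficiency_def using assms by (intro INF_lower2[OF assms(1)] SUP_least) auto

theorem theorem4:
  fixes p q :: real
  assumes "0 < p" and "p < 1" and "q = 1 - p"
  shows "\<exists>C>0. \<forall>r0>0.
    le_cam_distance (count_space UNIV) borel {r0..}
      (\<lambda>r. neg_binomial_measure r p)
      (\<lambda>r. normal_measure (r * p / q) (r * p / q\<^sup>2))
    \<le> ennreal (C * r0 powr (- 1 / 2))"
proof -
  obtain C where C: "C > 0"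
    "\<And>r. r > 0 \<Longrightarrow> (\<integral>x. \<bar>negbin_ext r p \<lfloor>x\<rfloor> - normal_density (r * p / q) (sqrt (r * p / q\<^sup>2)) x\<bar> \<partial>lborel)
        \<le> C / sqrt r"
    using negbin_normal_L1_bound[OF assms] by blast
  let ?T1 = "\<lambda>k. uniform_measure lborel {real k..<real k + 1}"
  let ?g = "\<lambda>x::real. nat \<lfloor>x\<rfloor>"
  let ?T2 = "\<lambda>x. return (count_space UNIV) (?g x)"
  have T1: "?T1 \<in> count_space UNIV \<rightarrow>\<^sub>M prob_algebra borel"
    by (auto simp: space_prob_algebra intro!: prob_space_uniform_measure)
  have g: "?g \<in> borel \<rightarrow>\<^sub>M count_space UNIV" by measurable
  have T2: "?T2 \<in> borel \<rightarrow>\<^sub>M prob_algebra (count_space UNIV)"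
    by measurable
  have main: "le_cam_distance (count_space UNIV) borel {r0..}
      (\<lambda>r. neg_binomial_measure r p) (\<lambda>r. normal_measure (r * p / q) (r * p / q\<^sup>2))
      \<le> ennreal (C * r0 powr (- 1 / 2))" if r0: "r0 > 0" for r0
    unfolding le_cam_distance_def
  proof (intro max.boundedI deficiency_leI[OF T1] deficiency_leI[OF T2])
    fix r assume "r \<in> {r0..}"
    then have r: "r > 0" "r0 \<le> r" using r0 by auto
    define s where "s x = negbin_ext r p \<lfloor>x\<rfloor>" for x :: real
    define \<phi> where "\<phi> = normal_density (r * p / q) (sqrt (r * p / q\<^sup>2))"
    have s: "integrable lborel s" "\<And>x. s x \<ge> 0"
      using negbin_ext_integrable[OF r(1) assms(1,2)] negbin_ext_nonneg[OF r(1) assms(1,2)]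
      by (auto simp: s_def[abs_def])
    have "sqrt (r * p / q\<^sup>2) > 0" using r assms by simp
    then have \<phi>: "integrable lborel \<phi>" "\<And>x. \<phi> x \<ge> 0"
      by (auto simp: \<phi>_def normal_density_nonneg)
    have N: "normal_measure (r * p / q) (r * p / q\<^sup>2) = density lborel \<phi>"
      by (simp add: normal_measure_def \<phi>_def)
    have "C / sqrt r \<le> C / sqrt r0"
      using C r r0 by (intro divide_left_mono) auto
    also have "\<dots> = C * r0 powr (- 1 / 2)"
      using r0 by (simp add: powr_minus_divide powr_half_sqrt)
    finally have "(\<integral>x. \<bar>s x - \<phi> x\<bar> \<partial>lborel) \<le> C * r0 powr (- 1 / 2)"
      using C(2)[OF r(1)] by (simp add: s_def \<phi>_def)
    moreover have "(\<integral>\<^sup>+x. ennreal \<bar>s x - \<phi> x\<bar> \<partial>lborel) = ennreal (\<integral>x. \<bar>s x - \<phi> x\<bar> \<partial>lborel)"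
      using s \<phi> by (intro nn_integral_eq_integral) auto
    ultimately have L1: "(\<integral>\<^sup>+x. ennreal \<bar>s x - \<phi> x\<bar> \<partial>lborel) \<le> ennreal (C * r0 powr (- 1 / 2))"
      by (simp add: ennreal_leI)
    have "distr (density lborel k) borel (\<lambda>x. x) = density lborel k" for k :: "real \<Rightarrow> ennreal"
      by (intro distr_id2) simp
    then have "tv_norm_diff (density lborel s) (density lborel \<phi>) \<le> (\<integral>\<^sup>+x. ennreal \<bar>s x - \<phi> x\<bar> \<partial>lborel)"
      using tv_norm_diff_distr_density_le[OF s \<phi>, of "\<lambda>x. x" borel] by simp
    with L1 show "tv_norm_diff (Giry_Monad.bind (neg_binomial_measure r p) ?T1)
        (normal_measure (r * p / q) (r * p / q\<^sup>2)) \<le> ennreal (C * r0 powr (- 1 / 2))"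
      unfolding bind_uniform_neg_binomial[OF r(1) assms(1,2)] N s_def[symmetric] by (rule order_trans[rotated])
    have "Giry_Monad.bind (density lborel \<phi>) ?T2 = distr (density lborel \<phi>) (count_space UNIV) ?g"
      using g by (intro bind_return_distr') auto
    moreover have "neg_binomial_measure r p = distr (density lborel s) (count_space UNIV) ?g"
      using distr_floor_negbin_ext[OF r(1) assms(1,2)] by (simp add: s_def)
    moreover have "tv_norm_diff (distr (density lborel \<phi>) (count_space UNIV) ?g) (distr (density lborel s) (count_space UNIV) ?g)
        \<le> (\<integral>\<^sup>+x. ennreal \<bar>s x - \<phi> x\<bar> \<partial>lborel)"
      using tv_norm_diff_distr_density_le[OF \<phi> s, of ?g "count_space UNIV"] g
      by (simp add: abs_minus_commute)
    ultimately show "tv_norm_diff (Giry_Monad.bind (normal_measure (r * p / q) (r * p / q\<^sup>2)) ?T2)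
        (neg_binomial_measure r p) \<le> ennreal (C * r0 powr (- 1 / 2))"
      using L1 N by simp
  qed
  then show ?thesis using C(1) by blast
qed

end
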